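(* Let $\Sigma=\{0,1\}$, $A_0,A_1:\mathbb{R}^n\to\mathbb{R}^n$, and consider the system $x_{k+1}=A_{\sigma_k}(x_k)+w_k$, $x_0\in\mathbb{R}^n$, $\sigma_k\in\Sigma$, $w_k\in\mathbb{R}^n$. Let $\alpha>0$, $\beta>0$, $\rho_0>0$, $\rho_1>0$ be parameters of a linear convergence rate abstraction for weak execution of this system, with $\rho_1\ge\rho_0$. Let $m,K$ be integers with $0\le m\le K$, $K\ge1$, and set $$\tilde\rho:=\rho_0^{\frac{m}{K}}\rho_1^{\frac{K-m}{K}},\qquad \tilde\alpha:=\left(\frac{\rho_1}{\rho_0}\right)^{K-m}.$$ If $\tilde\rho<1$, then for $w_k\equiv0$ and $(m,K)$-weak execution the system is exponentially stable: for every execution sequence $(\sigma_k)$ obeying $(m,K)$-weak execution, $$|x_k|\le\alpha\,\tilde\alpha\,\tilde\rho^{\,k}|x_0|\qquad\forall k\ge0,\ \forall x_0\in\mathbb{R}^n .$$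
   Context: $|\cdot|$ is the Euclidean norm on $\mathbb{R}^n$. $\sigma_k=0$ means the controller is executed normally in step $k$; $\sigma_k=1$ means it is skipped. Linear convergence rate abstraction for weak execution: parameters $\alpha,\beta,\rho_0,\rho_1>0$ such that for every $x_0\in\mathbb{R}^n$, every sequence $(\sigma_k)$ in $\Sigma$ and every $(w_k)$ in $\mathbb{R}^n$, the solution of $x_{k+1}=A_{\sigma_k}(x_k)+w_k$ satisfies $|x_k|\le\bar v_k$ for all $k\ge0$, where $\bar v_{k+1}=\rho_{\sigma_k}\bar v_k+\beta|w_k|$ and $\bar v_0=\alpha|x_0|$. $(m,K)$-weak execution: the sequence $(\sigma_k)_{k\ge0}$ in $\{0,1\}$ satisfies $\sum_{i=k}^{k+K-1}\sigma_i\le K-m$ for all $k\ge0$, i.e. in any $K$ consecutive periods at least $m$ are executed normally. *)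

theory Defs
  imports "HOL-Analysis.Analysis"
begin

text \<open>
  The modes are the numbers 0 (controller executed normally) and 1 (controller skipped). The
  families \<open>A\<close> and \<open>\<rho>\<close> are indexed by \<open>nat\<close>, but only their members at 0 and 1 are ever used,
  since execution sequences take values in \<open>modes\<close>.
\<close>

definition modes :: "nat set" where
  "modes = {0, 1}"

primrec solution ::
  "(nat \<Rightarrow> real ^ 'n \<Rightarrow> real ^ 'n) \<Rightarrow> (nat \<Rightarrow> nat) \<Rightarrow> (nat \<Rightarrow> real ^ 'n) \<Rightarrow> real ^ 'n
    \<Rightarrow> nat \<Rightarrow> real ^ 'n"
where
  "solution A \<sigma> w x0 0 = x0"
| "solution A \<sigma> w x0 (Suc k) = A (\<sigma> k) (solution A \<sigma> w x0 k) + w k"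

primrec rate_bound ::
  "real \<Rightarrow> real \<Rightarrow> (nat \<Rightarrow> real) \<Rightarrow> (nat \<Rightarrow> nat) \<Rightarrow> (nat \<Rightarrow> real ^ 'n) \<Rightarrow> real ^ 'n \<Rightarrow> nat \<Rightarrow> real"
where
  "rate_bound \<alpha> \<beta> \<rho> \<sigma> w x0 0 = \<alpha> * norm x0"
| "rate_bound \<alpha> \<beta> \<rho> \<sigma> w x0 (Suc k) = \<rho> (\<sigma> k) * rate_bound \<alpha> \<beta> \<rho> \<sigma> w x0 k + \<beta> * norm (w k)"

definition linear_rate_abstraction ::
  "(nat \<Rightarrow> real ^ 'n \<Rightarrow> real ^ 'n) \<Rightarrow> real \<Rightarrow> real \<Rightarrow> (nat \<Rightarrow> real) \<Rightarrow> bool"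
where
  "linear_rate_abstraction A \<alpha> \<beta> \<rho> \<longleftrightarrow>
     \<alpha> > 0 \<and> \<beta> > 0 \<and> \<rho> 0 > 0 \<and> \<rho> 1 > 0 \<and>
     (\<forall>x0 \<sigma> w. (\<forall>k. \<sigma> k \<in> modes) \<longrightarrow>
        (\<forall>k. norm (solution A \<sigma> w x0 k) \<le> rate_bound \<alpha> \<beta> \<rho> \<sigma> w x0 k))"

definition weak_executions :: "nat \<Rightarrow> nat \<Rightarrow> (nat \<Rightarrow> nat) set" where
  "weak_executions m K =
     {\<sigma>. (\<forall>k. \<sigma> k \<in> modes) \<and> (\<forall>k. int (\<Sum>i = k..<k + K. \<sigma> i) \<le> int K - int m)}"

text \<open>
  Exponential stability of the undisturbed system, uniformly over a set \<open>S\<close> of execution sequences.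
\<close>

definition exponentially_stable ::
  "(nat \<Rightarrow> real ^ 'n \<Rightarrow> real ^ 'n) \<Rightarrow> (nat \<Rightarrow> nat) set \<Rightarrow> bool"
where
  "exponentially_stable A S \<longleftrightarrow>
     (\<exists>C > 0. \<exists>r. 0 < r \<and> r < 1 \<and>
        (\<forall>\<sigma> \<in> S. \<forall>x0 k. norm (solution A \<sigma> (\<lambda>_. 0) x0 k) \<le> C * r ^ k * norm x0))"

definition rho_tilde :: "(nat \<Rightarrow> real) \<Rightarrow> nat \<Rightarrow> nat \<Rightarrow> real" where
  "rho_tilde \<rho> m K = \<rho> 0 powr (real m / real K) * \<rho> 1 powr ((real K - real m) / real K)"

text \<open>The exponent is a truncated subtraction; it is only used for \<open>m \<le> K\<close>.\<close>

definition alpha_tilde :: "(nat \<Rightarrow> real) \<Rightarrow> nat \<Rightarrow> nat \<Rightarrow> real" where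
  "alpha_tilde \<rho> m K = (\<rho> 1 / \<rho> 0) ^ (K - m)"

end

theory Submission
  imports Defs
begin

text \<open>
  Without disturbance the bound after \<open>k\<close> steps is \<open>\<alpha> \<rho>\<^sub>0\<^sup>k q\<^sup>s |x\<^sub>0|\<close>, where \<open>q = \<rho>\<^sub>1 / \<rho>\<^sub>0 \<ge> 1\<close> and \<open>s\<close> is
  the number of skips among the first \<open>k\<close> steps. Covering these steps by windows of length \<open>K\<close>
  gives \<open>s \<le> (K - m) (1 + k / K)\<close>; the claim follows since the rate of the theorem equals
  \<open>\<rho>\<^sub>0 q powr ((K - m) / K)\<close>.
\<close>

text \<open>Strong induction removes the last window of length \<open>K\<close>. The fewer than
  \<open>K\<close> steps left at the end are charged as one full window, hence \<open>k + K\<close>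
  in place of \<open>k\<close>. Multiplying by \<open>K\<close> avoids division in
  \<open>nat\<close>.\<close>

lemma prefix_sum_le_of_window_sum_le:
  fixes \<sigma> :: "nat \<Rightarrow> nat"
  assumes window: "\<And>k. (\<Sum>i = k..<k + K. \<sigma> i) \<le> d" and "K \<ge> 1"
  shows "K * (\<Sum>i<k. \<sigma> i) \<le> d * (k + K)"
proof (induction k rule: less_induct)
  case (less k)
  show ?case
  proof (cases "k < K")
    case True
    have "(\<Sum>i<k. \<sigma> i) \<le> (\<Sum>i = 0..<0 + K. \<sigma> i)"
      using True by (intro sum_mono2) auto
    also have "\<dots> \<le> d" by (rule window)
    finally have "K * (\<Sum>i<k. \<sigma> i) \<le> K * d" by (rule mult_le_mono2)
    also have "\<dots> \<le> d * (k + K)" by (simp add: algebra_simps)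
    finally show ?thesis .
  next
    case False
    then obtain j where k: "k = j + K" by (metis add.commute le_Suc_ex not_less)
    have "(\<Sum>i<k. \<sigma> i) = (\<Sum>i<j. \<sigma> i) + (\<Sum>i = j..<j + K. \<sigma> i)"
      unfolding k lessThan_atLeast0 by (rule sum.atLeastLessThan_concat [symmetric]) auto
    then have "K * (\<Sum>i<k. \<sigma> i) \<le> K * (\<Sum>i<j. \<sigma> i) + K * d"
      using window [of j] by (simp add: add_mult_distrib2)
    also have "\<dots> \<le> d * (j + K) + K * d"
      \<comment> \<open>\<open>K \<ge> 1\<close> ensures \<open>j < k\<close>.\<close>
      using less.IH [of j] k \<open>K \<ge> 1\<close> by simp
    finally show ?thesis using k by (simp add: algebra_simps)
  qed
qed

text \<open>As the modes are the numbers 0 and 1, a mode can serve as an exponent of the ratio: each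
  skip contributes one factor \<open>\<rho> 1 / \<rho> 0\<close>.\<close>

lemma rate_bound_undisturbed:
  assumes "\<And>k. \<sigma> k \<in> modes" and "\<rho> 0 \<noteq> 0"
  shows "rate_bound \<alpha> \<beta> \<rho> \<sigma> (\<lambda>_. 0) x0 k
    = \<alpha> * norm x0 * (\<rho> 0 ^ k * (\<rho> 1 / \<rho> 0) ^ (\<Sum>i<k. \<sigma> i))"
proof (induction k)
  case (Suc k)
  consider "\<sigma> k = 0" | "\<sigma> k = 1" using assms(1) [of k] by (auto simp: modes_def)
  then have "\<rho> (\<sigma> k) = \<rho> 0 * (\<rho> 1 / \<rho> 0) ^ \<sigma> k"
    using assms(2) by cases auto
  then show ?case by (simp add: Suc power_add mult_ac)
qed simp

text \<open>The exponents \<open>m / K\<close> and \<open>(K - m) / K\<close> add up to 1. This form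
  matches the factorization in \<open>rate_bound_undisturbed\<close>.\<close>

lemma rho_tilde_eq:
  assumes "\<rho> 0 > 0" "\<rho> 1 > 0" "m \<le> K" "K \<ge> 1"
  shows "rho_tilde \<rho> m K = \<rho> 0 * (\<rho> 1 / \<rho> 0) powr (real (K - m) / real K)"
proof -
  have "real m / real K = 1 - real (K - m) / real K"
    using assms by (simp add: field_simps of_nat_diff)
  then show ?thesis
    using assms by (simp add: rho_tilde_def of_nat_diff powr_diff powr_divide)
qed

text \<open>In the bound on the number of skips, the constant term \<open>K - m\<close> yields
  \<open>alpha_tilde\<close>, and the term linear in \<open>k\<close> yields the power of
  \<open>rho_tilde\<close>.\<close>

lemma weak_execution_factor_le:
  assumes "\<sigma> \<in> weak_executions m K"
    and "0 < \<rho> 0" "\<rho> 0 \<le> \<rho> 1" "m \<le> K" "K \<ge> 1"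
  shows "\<rho> 0 ^ k * (\<rho> 1 / \<rho> 0) ^ (\<Sum>i<k. \<sigma> i) \<le> alpha_tilde \<rho> m K * rho_tilde \<rho> m K ^ k"
proof -
  define q where "q = \<rho> 1 / \<rho> 0"
  define s where "s = (\<Sum>i<k. \<sigma> i)"
  have q: "q \<ge> 1" using assms by (simp add: q_def)
  have "int (\<Sum>i = j..<j + K. \<sigma> i) \<le> int K - int m" for j
    using assms(1) by (simp add: weak_executions_def)
  then have "(\<Sum>i = j..<j + K. \<sigma> i) \<le> K - m" for j
    by (metis assms(4) of_nat_diff of_nat_le_iff)
  then have "K * s \<le> (K - m) * (k + K)"
    unfolding s_def using assms(5) by (rule prefix_sum_le_of_window_sum_le)
  then have "real K * real s \<le> real (K - m) * (real k + real K)"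
    by (metis of_nat_add of_nat_le_iff of_nat_mult)
  then have s: "real s \<le> real (K - m) + real (K - m) / real K * real k"
    using assms(5) by (simp add: field_simps)
  have "q ^ s = q powr real s" using q by (simp add: powr_realpow)
  \<comment> \<open>The bound on \<open>s\<close> need not be an integer, hence \<open>powr\<close>;
    monotonicity in the exponent rests on \<open>q \<ge> 1\<close>, that is, on
    \<open>\<rho> 0 \<le> \<rho> 1\<close>.\<close>
  also have "\<dots> \<le> q powr (real (K - m) + real (K - m) / real K * real k)"
    using s q by (rule powr_mono)
  also have "\<dots> = q ^ (K - m) * (q powr (real (K - m) / real K)) ^ k"
    using q by (simp add: powr_add powr_realpow powr_power mult.commute)
  finally have "\<rho> 0 ^ k * q ^ s
      \<le> \<rho> 0 ^ k * (q ^ (K - m) * (q powr (real (K - m) / real K)) ^ k)"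
    using assms(2) by (intro mult_left_mono) auto
  also have "\<dots> = alpha_tilde \<rho> m K * rho_tilde \<rho> m K ^ k"
    using assms by (simp add: rho_tilde_eq alpha_tilde_def q_def power_mult_distrib)
  finally show ?thesis by (simp add: q_def s_def)
qed

theorem theorem7p2:
  fixes A :: "nat \<Rightarrow> real ^ 'n \<Rightarrow> real ^ 'n"
    and \<alpha> \<beta> :: real and \<rho> :: "nat \<Rightarrow> real" and m K :: nat
  assumes "linear_rate_abstraction A \<alpha> \<beta> \<rho>"
    and "\<rho> 1 \<ge> \<rho> 0"
    and "m \<le> K" and "K \<ge> 1"
    and "rho_tilde \<rho> m K < 1"
  shows "exponentially_stable A (weak_executions m K) \<and>
    (\<forall>\<sigma> \<in> weak_executions m K. \<forall>x0 k.
      norm (solution A \<sigma> (\<lambda>_. 0) x0 k)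
        \<le> \<alpha> * alpha_tilde \<rho> m K * rho_tilde \<rho> m K ^ k * norm x0)"
proof -
  have pos: "\<alpha> > 0" "\<rho> 0 > 0" "\<rho> 1 > 0"
    using assms(1) by (auto simp: linear_rate_abstraction_def)
  have bound: "norm (solution A \<sigma> (\<lambda>_. 0) x0 k)
      \<le> \<alpha> * alpha_tilde \<rho> m K * rho_tilde \<rho> m K ^ k * norm x0"
    if \<sigma>: "\<sigma> \<in> weak_executions m K" for \<sigma> x0 k
  proof -
    have modes: "\<And>k. \<sigma> k \<in> modes" using \<sigma> by (simp add: weak_executions_def)
    have "norm (solution A \<sigma> (\<lambda>_. 0) x0 k) \<le> rate_bound \<alpha> \<beta> \<rho> \<sigma> (\<lambda>_. 0) x0 k"
      using assms(1) modes unfolding linear_rate_abstraction_def by blast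
    also have "\<dots> = \<alpha> * norm x0 * (\<rho> 0 ^ k * (\<rho> 1 / \<rho> 0) ^ (\<Sum>i<k. \<sigma> i))"
      using pos by (intro rate_bound_undisturbed modes) simp
    also have "\<dots> \<le> \<alpha> * norm x0 * (alpha_tilde \<rho> m K * rho_tilde \<rho> m K ^ k)"
      using \<sigma> pos assms by (intro mult_left_mono weak_execution_factor_le) auto
    finally show ?thesis by (simp add: mult_ac)
  qed
  \<comment> \<open>The stability witnesses are \<open>C = \<alpha> * alpha_tilde \<rho> m K\<close>
    and \<open>r = rho_tilde \<rho> m K\<close>.\<close>
  have "\<alpha> * alpha_tilde \<rho> m K > 0" using pos by (simp add: alpha_tilde_def)
  moreover have "rho_tilde \<rho> m K > 0" using pos by (simp add: rho_tilde_def)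
  ultimately show ?thesis
    unfolding exponentially_stable_def using bound assms(5) by blast
qed

end
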